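(* Let $q \in \mathbb{N}_+$ and let $s \in \mathbb{N}_+ \cup \{\infty\}$. There exist $n \in \mathbb{N}$ and a lattice $\mathcal{L} \subset \mathbb{R}^n$ of rank $n$ such that no basis $M = [\vec v_1,\dots,\vec v_n]$ of $\mathcal{L}$ satisfies the following two properties simultaneously: (1) $M$ contains a shortest nonzero lattice vector, i.e. $\|\vec v_i\|_q = \lambda_1^{(q)}(\mathcal{L})$ for some $i$; (2) $M$ minimizes, over all bases of $\mathcal{L}$, the quantity $\sum_{i=1}^n \|\vec v_i\|_q^{s}$ if $s<\infty$, respectively the quantity $\max_{1\le i\le n}\|\vec v_i\|_q$ if $s=\infty$.
   Context: For $\vec x \in \mathbb{R}^n$, $\|\vec x\|_q = (\sum_{i=1}^n |x_i|^q)^{1/q}$. A lattice is a discrete subgroup of $\mathbb{R}^n$; equivalently $\mathcal{L} = M\mathbb{Z}^k$ for a matrix $M\in\mathbb{R}^{n\times k}$ with linearly independent columns, called a basis of $\mathcal{L}$ ($k$ is the rank). $\mathcal{B}_q(r) = \{\vec x : \|\vec x\|_q < r\}$. The successive minima are $\lambda_i^{(q)}(\mathcal{L}) = \inf\{r>0 : \dim \operatorname{span}(\mathcal{L}\cap \mathcal{B}_q(r)) \ge i\}$; in particular $\lambda_1^{(q)}(\mathcal{L})$ is the $\ell^q$-length of a shortest nonzero lattice vector. *)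

theory Defs
  imports Complex_Main "HOL-Library.Extended_Nat"
begin

text \<open>Vectors of R^n are represented as functions nat => real, only the
  coordinates i < n being relevant.  A family of n vectors (a matrix with
  columns B 0, ..., B (n-1)) is a function B :: nat => nat => real.\<close>

definition qnorm :: "nat \<Rightarrow> nat \<Rightarrow> (nat \<Rightarrow> real) \<Rightarrow> real" where
  "qnorm q n x = (\<Sum>i<n. \<bar>x i\<bar> ^ q) powr (1 / real q)"

definition lin_indep :: "nat \<Rightarrow> (nat \<Rightarrow> nat \<Rightarrow> real) \<Rightarrow> bool" where
  "lin_indep n B \<longleftrightarrow>
     (\<forall>c :: nat \<Rightarrow> real. (\<forall>i<n. (\<Sum>j<n. c j * B j i) = 0) \<longrightarrow> (\<forall>j<n. c j = 0))"

definition lattice_of :: "nat \<Rightarrow> (nat \<Rightarrow> nat \<Rightarrow> real) \<Rightarrow> (nat \<Rightarrow> real) set" where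
  "lattice_of n B =
     {(\<lambda>i. if i < n then (\<Sum>j<n. real_of_int (c j) * B j i) else 0) | c :: nat \<Rightarrow> int. True}"

definition is_basis :: "nat \<Rightarrow> (nat \<Rightarrow> real) set \<Rightarrow> (nat \<Rightarrow> nat \<Rightarrow> real) \<Rightarrow> bool" where
  "is_basis n L B \<longleftrightarrow> lin_indep n B \<and> lattice_of n B = L"

definition lambda1 :: "nat \<Rightarrow> nat \<Rightarrow> (nat \<Rightarrow> real) set \<Rightarrow> real" where
  "lambda1 q n L = Inf {qnorm q n v | v. v \<in> L \<and> v \<noteq> (\<lambda>_. 0)}"

definition basis_cost :: "nat \<Rightarrow> enat \<Rightarrow> nat \<Rightarrow> (nat \<Rightarrow> nat \<Rightarrow> real) \<Rightarrow> real" where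
  "basis_cost q s n B =
     (case s of enat k \<Rightarrow> (\<Sum>j<n. qnorm q n (B j) ^ k)
              | \<infinity> \<Rightarrow> Max ((\<lambda>j. qnorm q n (B j)) ` {..<n}))"

end

theory Submission
  imports Defs
begin

text \<open>With \<open>m\<^sup>q = N (2\<^sup>q + 3\<^sup>q)\<close> and \<open>n = 2 N + 1\<close>, take the lattice in \<open>R\<^sup>n\<close> generated by
  \<open>h = (t, 2, \<dots>, 2, 3, \<dots>, 3)\<close> (\<open>N\<close> twos, \<open>N\<close> threes) and \<open>m e\<^sub>i\<close> for \<open>i \<noteq> 0\<close>, where \<open>t < 1\<close> is
  close to 1.  Its shortest vectors are \<open>\<plusminus>v\<close> with \<open>v = t m e\<^sub>0\<close>; in terms of the generators,
  \<open>v = m h - \<Sum> a\<^sub>i (m e\<^sub>i)\<close>, and no coefficient is a unit.  The generators have \<open>q\<close>-th power norm at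
  most \<open>m\<^sup>q + 1\<close>, whereas every nonzero lattice vector other than \<open>\<plusminus>v\<close> and \<open>\<plusminus>\<close> the generators has
  at least \<open>t\<^sup>q (m\<^sup>q + 2)\<close>.  Each vector short enough to miss that bound is a multiple of a single
  generator or has coefficients divisible by those of \<open>v\<close>; so if a basis contains \<open>\<plusminus>v\<close> and only
  such vectors, some generator \<open>l\<close> is not used by the other \<open>n - 1\<close> vectors, and then all \<open>l\<close>-th
  coefficients are divisible by that of \<open>v\<close>, which is absurd.  Hence a basis containing \<open>\<plusminus>v\<close> has
  a vector that is too long, and letting \<open>t\<close> be close to 1 makes its cost exceed that of the
  generators.\<close>

section \<open>Elementary facts on powers and residues\<close>

lemma sum_lessThan_add:
  fixes g :: "nat \<Rightarrow> 'a::comm_monoid_add"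
  shows "(\<Sum>i<a + b. g i) = (\<Sum>i<a. g i) + (\<Sum>i<b. g (a + i))"
  by (induction b) (auto simp: add.assoc)

text \<open>Because of this gap a single coordinate of absolute value at least 6 costs more than a
  whole pair 2, 3 of coordinates of \<open>h\<close>.\<close>

lemma two_three_power_le_six_power:
  assumes "q \<ge> 1"
  shows "(2::int) ^ q + 3 ^ q + 1 \<le> 6 ^ q"
  using assms
proof (induction q rule: dec_induct)
  case (step q)
  have "(0::int) < 2 ^ q" "(0::int) < 3 ^ q" by simp_all
  then show ?case using step.IH unfolding power_Suc by linarith
qed simp

lemma abs_le_power_int:
  fixes z :: int
  assumes "q \<ge> 1"
  shows "\<bar>z\<bar> \<le> \<bar>z\<bar> ^ q"
  using assms by (cases "z = 0") (simp_all add: self_le_power)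

lemma dvd_abs_less_imp_eq_0:
  fixes m z :: int
  assumes "m dvd z" "\<bar>z\<bar> < m"
  shows "z = 0"
  using dvd_imp_le_int[of z m] assms by fastforce

text \<open>Two integers of absolute value at most \<open>b\<close> differ by at most
  \<open>2 * b\<close>, so they cannot be congruent modulo \<open>m\<close> without being
  equal.\<close>

lemma dvd_diff_small_cases:
  fixes m y e :: int
  assumes "m dvd y - e" "\<bar>e\<bar> \<le> b" "2 * b < m"
  shows "y = e \<or> \<bar>e\<bar> < \<bar>y\<bar>"
proof (cases "\<bar>y\<bar> \<le> \<bar>e\<bar>")
  case True
  then have "\<bar>y - e\<bar> < m" using assms by arith
  from dvd_abs_less_imp_eq_0[OF assms(1) this] show ?thesis by simp
qed simp

text \<open>The difference \<open>d = r' - r\<close> is congruent to \<open>k\<close> and has size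
  at most 10. So \<open>r - 2 * d\<close> is a multiple of \<open>m\<close> of size at most 25,
  hence 0. Thus \<open>r = 2 * d\<close> and \<open>r' = 3 * d\<close>, and the bound 5 on
  \<open>r'\<close> leaves only -1, 0 and 1 for \<open>d\<close>.\<close>

lemma double_triple_residues_small:
  fixes m k r r' :: int
  assumes m: "m \<ge> 30" and r: "m dvd r - 2 * k" and r': "m dvd r' - 3 * k"
    and b: "\<bar>r\<bar> \<le> 5" "\<bar>r'\<bar> \<le> 5"
  shows "m dvd k \<or> m dvd k - 1 \<or> m dvd k + 1"
proof -
  define d where "d = r' - r"
  have dk: "m dvd d - k"
    using dvd_diff[OF r' r] by (simp add: d_def algebra_simps)
  have "m dvd (r - 2 * k) - 2 * (d - k)" by (intro dvd_diff r dvd_mult dk)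
  then have "m dvd r - 2 * d" by (simp add: algebra_simps)
  then have "r - 2 * d = 0" 
    by (rule dvd_abs_less_imp_eq_0) (use b m in \<open>unfold d_def, arith\<close>)
  moreover have "m dvd (r' - 3 * k) - 3 * (d - k)" by (intro dvd_diff r' dvd_mult dk)
  then have "m dvd r' - 3 * d" by (simp add: algebra_simps)
  then have "r' - 3 * d = 0"
    by (rule dvd_abs_less_imp_eq_0) (use \<open>r - 2 * d = 0\<close> b m in \<open>unfold d_def, arith\<close>)
  ultimately have "d = 0 \<or> d = 1 \<or> d = -1" using b by linarith
  then show ?thesis using dk by (auto simp: dvd_diff_commute)
qed

section \<open>Parameters of the lattice\<close>

locale exponent =
  fixes q :: nat
  assumes q: "q \<ge> 1"
begin

definition c :: nat where "c = 2 ^ q + 3 ^ q"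
text \<open>As \<open>c\<close> divides \<open>m\<close>, the quotient \<open>m^q / c\<close> is an
  integer, namely \<open>N\<close>. The factor 6 and \<open>c \<ge> 5\<close> give the bound 30
  required by \<open>double_triple_residues_small\<close>.\<close>

definition m :: nat where "m = 6 * c"
definition N :: nat where "N = c ^ (q - 1) * 6 ^ q"
definition n :: nat where "n = Suc (N + N)"

definition a :: "nat \<Rightarrow> nat" where
  "a i = (if i = 0 then 1 else if i \<le> N then 2 else 3)"

text \<open>Below, \<open>x\<close> is the vector of integer coefficients with respect to the generators; \<open>coord x\<close> is
  the lattice vector without the factor \<open>t\<close> in coordinate 0, which keeps the estimates integral.\<close>
definition coord :: "(nat \<Rightarrow> int) \<Rightarrow> nat \<Rightarrow> int" where
  "coord x i = (if i = 0 then x 0 else int (a i) * x 0 + int m * x i)"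

definition power_sum :: "(nat \<Rightarrow> int) \<Rightarrow> int" where
  "power_sum x = (\<Sum>i<n. \<bar>coord x i\<bar> ^ q)"

text \<open>The coefficients of \<open>v\<close> up to sign.\<close>
definition short_coeff :: "nat \<Rightarrow> nat" where
  "short_coeff i = (if i = 0 then m else a i)"

lemma c_ge: "c \<ge> 5"
proof -
  have "(2::nat) ^ 1 \<le> 2 ^ q" "(3::nat) ^ 1 \<le> 3 ^ q" using q by (intro power_increasing; simp)+
  then show ?thesis by (simp add: c_def)
qed

lemma m_ge: "m \<ge> 30"
  using c_ge by (simp add: m_def)

lemma N_ge: "N \<ge> 2"
proof -
  have "(6::nat) ^ 1 \<le> 6 ^ q" using q by (intro power_increasing) auto
  moreover have "1 \<le> c ^ (q - 1)" using c_ge by simp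
  ultimately have "1 * 6 \<le> c ^ (q - 1) * 6 ^ q" by (intro mult_le_mono) auto
  then show ?thesis by (simp add: N_def)
qed

lemma n_pos [simp]: "0 < n"
  by (simp add: n_def)

lemma m_power: "m ^ q = c * N"
proof -
  have "c * c ^ (q - 1) = c ^ q" using q by (cases q) auto
  then show ?thesis by (simp add: m_def N_def power_mult_distrib)
qed

lemma m_le_m_power: "m \<le> m ^ q"
  using q m_ge by (intro self_le_power) auto

text \<open>Each coordinate where \<open>h\<close> has a 2 is paired with one where it has a
  3.\<close>

lemma sum_n: "(\<Sum>i<n. f i) = f 0 + (\<Sum>i<N. f (Suc i) + f (Suc (N + i)))"
  for f :: "nat \<Rightarrow> 'a::comm_monoid_add"
  unfolding n_def sum.lessThan_Suc_shift sum_lessThan_add by (simp add: sum.distrib)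

lemma sum_a_power: "(\<Sum>i<n. a i ^ q) = Suc (m ^ q)"
  unfolding sum_n by (simp add: a_def m_power c_def algebra_simps)

lemma short_coeff_not_dvd_1: "\<not> int (short_coeff i) dvd 1" if "i < n"
  using m_ge by (auto simp: short_coeff_def a_def)

section \<open>Lower bounds for the power sum, and the short coefficient vectors\<close>

text \<open>If \<open>x 0\<close> is 1 or -1 modulo \<open>m\<close>, the residues of least size are
  those of \<open>h\<close> or \<open>-h\<close>, with power sum \<open>m^q + 1\<close>. Otherwise
  every one of the \<open>N\<close> pairs has an entry of size at least 6 and costs at least
  \<open>c + 1\<close>, in total at least \<open>m^q + N\<close>.\<close>

lemma power_sum_not_dvd:
  assumes nd: "\<not> int m dvd x 0"
  shows "power_sum x \<ge> int m ^ q + 1"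
    and "power_sum x < int m ^ q + 2 \<Longrightarrow> \<forall>i<n. i \<noteq> 0 \<longrightarrow> x i = 0"
proof -
  have "power_sum x \<ge> int m ^ q + 1 \<and>
    (power_sum x < int m ^ q + 2 \<longrightarrow> (\<forall>i<n. i \<noteq> 0 \<longrightarrow> x i = 0))"
  proof (cases "int m dvd x 0 - 1 \<or> int m dvd x 0 + 1")
    case True
    then obtain e :: int where e: "e = 1 \<or> e = -1" "int m dvd x 0 - e"
      by (metis diff_minus_eq_add)
    have dvd: "int m dvd coord x i - e * int (a i)" for i
    proof (cases "i = 0")
      case True
      then show ?thesis using e by (simp add: coord_def a_def)
    next
      case False
      have "int m dvd int (a i) * (x 0 - e) + int m * x i"
        by (intro dvd_add dvd_mult e dvd_triv_left)
      then show ?thesis using False by (simp add: coord_def algebra_simps)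
    qed
    have cases: "coord x i = e * int (a i) \<or> int (a i) < \<bar>coord x i\<bar>" for i
      using dvd_diff_small_cases[OF dvd, of i 3] e m_ge by (auto simp: abs_mult a_def)
    have le: "int (a i) ^ q \<le> \<bar>coord x i\<bar> ^ q" for i
      using cases[of i] e by (intro power_mono) (auto simp: abs_mult)
    have sa: "(\<Sum>i<n. int (a i) ^ q) = int m ^ q + 1"
      using arg_cong[OF sum_a_power, of int] by simp
    have ge: "power_sum x \<ge> int m ^ q + 1"
      unfolding power_sum_def sa[symmetric] by (intro sum_mono le)
    moreover have "x i = 0" if lt: "power_sum x < int m ^ q + 2" and i: "i < n" "i \<noteq> 0" for i
    proof -
      \<comment> \<open>One deviating coordinate pushes the integer \<open>power_sum x\<close>
        beyond \<open>m^q + 1\<close>, hence to at least \<open>m^q + 2\<close>.\<close>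
      have eq: "coord x j = e * int (a j)" if j: "j < n" for j
      proof (rule ccontr)
        assume "coord x j \<noteq> e * int (a j)"
        then have "int (a j) ^ q < \<bar>coord x j\<bar> ^ q"
          using cases[of j] q by (intro power_strict_mono) auto
        then have "(\<Sum>i<n. int (a i) ^ q) < power_sum x"
          unfolding power_sum_def using j le by (intro sum_strict_mono_ex1) auto
        then show False using lt sa by simp
      qed
      have "x 0 = e" using eq[of 0] by (simp add: coord_def a_def)
      then show ?thesis using eq[OF i(1)] i(2) m_ge by (simp add: coord_def)
    qed
    ultimately show ?thesis by blast
  next
    case False
    have pair: "int c + 1 \<le> \<bar>coord x (Suc i)\<bar> ^ q + \<bar>coord x (Suc (N + i))\<bar> ^ q" if "i < N" for i
    proof -
      let ?r = "coord x (Suc i)" and ?r' = "coord x (Suc (N + i))"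
      have "int m dvd ?r - 2 * x 0" "int m dvd ?r' - 3 * x 0"
        using that by (auto simp: coord_def a_def)
      then have "6 \<le> \<bar>?r\<bar> \<or> 6 \<le> \<bar>?r'\<bar>"
        using double_triple_residues_small[of "int m" ?r "x 0" ?r'] m_ge False nd by linarith
      then have "6 ^ q \<le> \<bar>?r\<bar> ^ q \<or> 6 ^ q \<le> \<bar>?r'\<bar> ^ q"
        by (auto intro: power_mono)
      moreover have "0 \<le> \<bar>?r\<bar> ^ q" "0 \<le> \<bar>?r'\<bar> ^ q" by simp_all
      moreover have "int c + 1 \<le> 6 ^ q"
        using two_three_power_le_six_power[OF q] by (simp add: c_def)
      ultimately show ?thesis by linarith
    qed
    have "int m ^ q + 2 \<le> int N * (int c + 1)"
      using N_ge arg_cong[OF m_power, of int] by (simp add: algebra_simps)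
    also have "\<dots> = (\<Sum>i<N. int c + 1)" by simp
    also have "\<dots> \<le> (\<Sum>i<N. \<bar>coord x (Suc i)\<bar> ^ q + \<bar>coord x (Suc (N + i))\<bar> ^ q)"
      by (intro sum_mono pair) simp
    also have "\<dots> \<le> power_sum x" unfolding power_sum_def sum_n by simp
    finally show ?thesis by simp
  qed
  then show "power_sum x \<ge> int m ^ q + 1"
    and "power_sum x < int m ^ q + 2 \<Longrightarrow> \<forall>i<n. i \<noteq> 0 \<longrightarrow> x i = 0" by auto
qed

text \<open>If \<open>m\<close> divides \<open>x 0\<close>, the lattice vector lies in the sublattice \<open>m Z\<^sup>n\<close> (up to \<open>t\<close>), and these
  are its coordinates there.\<close>
definition reduced :: "(nat \<Rightarrow> int) \<Rightarrow> nat \<Rightarrow> int" where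
  "reduced x i = (if i = 0 then x 0 div int m else int (a i) * (x 0 div int m) + x i)"

lemma coord_reduced: "int m dvd x 0 \<Longrightarrow> coord x i = int m * reduced x i"
  by (auto simp: coord_def reduced_def algebra_simps)

lemma power_sum_dvd:
  assumes "int m dvd x 0"
  shows "power_sum x = int m ^ q * (\<Sum>i<n. \<bar>reduced x i\<bar> ^ q)"
  unfolding power_sum_def coord_reduced[of x, OF assms]
  by (simp add: abs_mult power_mult_distrib sum_distrib_left)

text \<open>Such a vector is a multiple of \<open>v\<close>, with factor
  \<open>x 0 div m\<close>.\<close>

lemma reduced_0_imp_dvd:
  assumes "int m dvd x 0" "\<forall>i<n. i \<noteq> 0 \<longrightarrow> reduced x i = 0"
  shows "\<forall>i<n. int (short_coeff i) dvd x i"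
proof (intro allI impI)
  fix i assume i: "i < n"
  show "int (short_coeff i) dvd x i"
  proof (cases "i = 0")
    case False
    then have "x i = int (a i) * - (x 0 div int m)"
      using assms(2) i by (simp add: reduced_def add_eq_0_iff)
    then show ?thesis using False by (simp add: short_coeff_def)
  qed (use assms in \<open>simp add: short_coeff_def\<close>)
qed

lemma sum_reduced_ge:
  assumes "l \<in> I" "finite I" "reduced x l \<noteq> 0"
  shows "(\<Sum>i\<in>I. \<bar>reduced x i\<bar> ^ q) \<ge> 1"
proof -
  have "1 \<le> \<bar>reduced x l\<bar>" using assms by simp
  also have "\<dots> \<le> \<bar>reduced x l\<bar> ^ q" by (rule abs_le_power_int[OF q])
  also have "\<dots> \<le> (\<Sum>i\<in>I. \<bar>reduced x i\<bar> ^ q)"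
    using assms by (intro member_le_sum) auto
  finally show ?thesis .
qed

text \<open>If \<open>m\<close> does not divide \<open>x 0\<close>, only multiples of
  \<open>h\<close> are this short. If it does, two nonzero reduced coordinates would cost
  \<open>2 * m^q\<close>, which is at least \<open>m^q + 2\<close>. So at most one is nonzero: in
  position 0 this gives a multiple of \<open>v\<close>, elsewhere a multiple of a generator.\<close>

lemma short_cases:
  assumes lt: "power_sum x < int m ^ q + 2"
  shows "(\<exists>l<n. \<forall>i<n. i \<noteq> l \<longrightarrow> x i = 0) \<or> (\<forall>i<n. int (short_coeff i) dvd x i)"
proof (cases "int m dvd x 0")
  case False
  then show ?thesis using power_sum_not_dvd(2)[OF False lt] n_pos by blast
next
  case True
  show ?thesis
  proof (cases "\<forall>i<n. i \<noteq> 0 \<longrightarrow> reduced x i = 0")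
    case True
    then show ?thesis using reduced_0_imp_dvd[of x, OF \<open>int m dvd x 0\<close>] by blast
  next
    case False
    then obtain l where l: "l < n" "l \<noteq> 0" "reduced x l \<noteq> 0" by blast
    have zero: "reduced x i = 0" if "i < n" "i \<noteq> l" for i
    proof (rule ccontr)
      assume nz: "reduced x i \<noteq> 0"
      have "1 \<le> (\<Sum>i\<in>{..<n} - {l}. \<bar>reduced x i\<bar> ^ q)"
        using that nz by (intro sum_reduced_ge[of i]) auto
      moreover have "1 \<le> \<bar>reduced x l\<bar> ^ q"
        using l sum_reduced_ge[of l "{l}" x] by simp
      moreover have "(\<Sum>i<n. \<bar>reduced x i\<bar> ^ q) =
          \<bar>reduced x l\<bar> ^ q + (\<Sum>i\<in>{..<n} - {l}. \<bar>reduced x i\<bar> ^ q)"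
        using l by (intro sum.remove) auto
      ultimately have "2 \<le> (\<Sum>i<n. \<bar>reduced x i\<bar> ^ q)" by linarith
      then have "int m ^ q * 2 \<le> power_sum x"
        unfolding power_sum_dvd[of x, OF True] by (intro mult_left_mono) auto
      moreover have "2 \<le> int m ^ q" 
        using of_nat_mono[of 2 "m ^ q", where ?'a = int] m_ge m_le_m_power by simp
      ultimately show False using lt by simp
    qed
    have "x 0 = 0" using zero[of 0] l dvd_mult_div_cancel[OF True] by (simp add: reduced_def)
    then have "reduced x i = x i" for i by (simp add: reduced_def)
    then have "\<forall>i<n. i \<noteq> l \<longrightarrow> x i = 0" using zero by simp
    then show ?thesis using l by blast
  qed
qed

lemma power_sum_ge:
  assumes nz: "\<exists>i<n. x i \<noteq> 0"
  shows "power_sum x \<ge> int m ^ q"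
proof (cases "int m dvd x 0")
  case False
  then show ?thesis using power_sum_not_dvd(1)[of x] by simp
next
  case True
  have "\<exists>i<n. reduced x i \<noteq> 0"
  proof (rule ccontr)
    assume "\<not> ?thesis"
    then have z: "\<And>i. i < n \<Longrightarrow> reduced x i = 0" by blast
    have "x 0 = 0" using z[of 0] dvd_mult_div_cancel[OF True] by (simp add: reduced_def)
    then have "x i = 0" if "i < n" for i
      using z[OF that] by (simp add: reduced_def split: if_splits)
    then show False using nz by blast
  qed
  then obtain l where "l < n" "reduced x l \<noteq> 0" by blast
  then have "1 \<le> (\<Sum>i<n. \<bar>reduced x i\<bar> ^ q)" by (intro sum_reduced_ge[of l]) auto
  then have "int m ^ q * 1 \<le> power_sum x"
    unfolding power_sum_dvd[of x, OF True] by (intro mult_left_mono) auto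
  then show ?thesis by simp
qed

section \<open>The real lattice and its coefficient vectors\<close>

definition lat_vec :: "real \<Rightarrow> (nat \<Rightarrow> int) \<Rightarrow> nat \<Rightarrow> real" where
  "lat_vec t x i = (if i = 0 then t else 1) * of_int (coord x i)"

definition basis :: "real \<Rightarrow> nat \<Rightarrow> nat \<Rightarrow> real" where
  "basis t j i = (if j = 0 then (if i = 0 then t else real (a i))
                  else if i = j then real m else 0)"

lemma sum_basis:
  assumes "i < n"
  shows "(\<Sum>j<n. x j * basis t j i) = (if i = 0 then t * x 0 else real (a i) * x 0 + real m * x i)"
proof -
  have "(\<Sum>j<n. x j * basis t j i) =
      x 0 * basis t 0 i + (\<Sum>j\<in>{..<n} - {0}. if j = i then real m * x i else 0)"
    unfolding sum.remove[of "{..<n}" 0, simplified]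
    by (intro arg_cong2[where f = "(+)"] sum.cong) (auto simp: basis_def)
  then show ?thesis using assms by (auto simp: basis_def)
qed

lemma sum_basis_of_int:
  assumes "i < n"
  shows "(\<Sum>j<n. of_int (x j) * basis t j i) = lat_vec t x i"
  unfolding sum_basis[OF assms] by (simp add: lat_vec_def coord_def)

lemma lin_indep_basis:
  assumes "t > 0"
  shows "lin_indep n (basis t)"
  unfolding lin_indep_def
proof (intro allI impI)
  fix x :: "nat \<Rightarrow> real" and j
  assume z: "\<forall>i<n. (\<Sum>j<n. x j * basis t j i) = 0" and j: "j < n"
  have x0: "x 0 = 0" using z[rule_format, of 0] assms by (simp add: sum_basis)
  show "x j = 0"
    using z[rule_format, OF j] x0 m_ge by (simp add: sum_basis j split: if_splits)
qed

lemma lattice_basis: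
  "lattice_of n (basis t) = range (\<lambda>x i. if i < n then lat_vec t x i else 0)"
  unfolding lattice_of_def by (auto simp: sum_basis_of_int cong: if_cong)

lemma lat_vec_sum:
  "lat_vec t (\<lambda>l. \<Sum>j\<in>J. d j * X j l) i = (\<Sum>j\<in>J. of_int (d j) * lat_vec t (X j) i)"
  by (simp add: lat_vec_def coord_def sum_distrib_left sum.distrib algebra_simps)

lemma lat_vec_inj:
  assumes "t > 0" and eq: "\<And>i. i < n \<Longrightarrow> lat_vec t x i = lat_vec t y i" and i: "i < n"
  shows "x i = y i"
proof -
  have "x 0 = y 0" using eq[of 0] assms(1) by (simp add: lat_vec_def coord_def)
  moreover have "coord x i = coord y i"
    using eq[OF i] assms(1) by (cases "i = 0") (simp_all add: lat_vec_def)
  ultimately show ?thesis using m_ge by (cases "i = 0") (simp_all add: coord_def)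
qed

section \<open>Norms of the generators and of lattice vectors\<close>

lemma qnorm_cong: "(\<And>i. i < n \<Longrightarrow> u i = v i) \<Longrightarrow> qnorm q n u = qnorm q n v"
  by (simp add: qnorm_def)

lemma powr_inverse_le_iff:
  fixes u v :: real
  assumes "0 \<le> u" "0 \<le> v"
  shows "u powr (1 / real q) \<le> v powr (1 / real q) \<longleftrightarrow> u \<le> v"
  using powr_mono2[of "1 / real q" u v] powr_less_mono2[of "1 / real q" v u] assms q
  by (auto simp: not_less[symmetric])

lemma qnorm_ge_iff:
  assumes "b \<ge> 0"
  shows "b powr (1 / real q) \<le> qnorm q n u \<longleftrightarrow> b \<le> (\<Sum>i<n. \<bar>u i\<bar> ^ q)"
  unfolding qnorm_def using assms by (simp add: powr_inverse_le_iff sum_nonneg)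

lemma power_powr_inverse: "b \<ge> 0 \<Longrightarrow> (b ^ q) powr (1 / real q) = b" for b :: real
  using q by (simp add: powr_realpow' [symmetric] powr_powr)

lemma sum_lat_vec:
  assumes "t > 0"
  shows "(\<Sum>i<n. \<bar>lat_vec t x i\<bar> ^ q) =
    t ^ q * \<bar>of_int (x 0)\<bar> ^ q + (\<Sum>i\<in>{..<n} - {0}. \<bar>of_int (coord x i)\<bar> ^ q)"
  unfolding sum.remove[of "{..<n}" 0, simplified] using assms
  by (auto intro!: sum.cong simp: lat_vec_def coord_def abs_mult power_mult_distrib)

text \<open>Only coordinate 0 carries the factor \<open>t\<close>; shrinking all the others by
  \<open>t \<le> 1\<close> as well can only decrease the sum.\<close>

lemma sum_lat_vec_ge:
  assumes "0 < t" "t \<le> 1"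
  shows "t ^ q * of_int (power_sum x) \<le> (\<Sum>i<n. \<bar>lat_vec t x i\<bar> ^ q)"
proof -
  have "t ^ q * \<bar>of_int (coord x i)\<bar> ^ q \<le> \<bar>lat_vec t x i\<bar> ^ q" for i
    using assms power_le_one[of t q]
    by (auto simp: lat_vec_def abs_mult power_mult_distrib mult_left_le_one_le)
  then show ?thesis unfolding power_sum_def
    by (simp add: sum_distrib_left sum_mono)
qed

lemma qnorm_basis_0:
  assumes "0 < t" "t \<le> 1"
  shows "qnorm q n (basis t 0) \<le> (real m ^ q + 1) powr (1 / real q)"
proof -
  have "(\<Sum>i<n. \<bar>basis t 0 i\<bar> ^ q) \<le> (\<Sum>i<n. real (a i) ^ q)"
    using assms by (intro sum_mono power_mono) (auto simp: basis_def a_def)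
  also have "\<dots> = real m ^ q + 1"
    using arg_cong[OF sum_a_power, of real] by simp
  finally show ?thesis unfolding qnorm_def by (intro powr_mono2) (auto intro: sum_nonneg)
qed

lemma qnorm_basis:
  assumes "j < n" "j \<noteq> 0"
  shows "qnorm q n (basis t j) = real m"
proof -
  have "(\<Sum>i<n. \<bar>basis t j i\<bar> ^ q) = (\<Sum>i<n. if i = j then real m ^ q else 0)"
    using assms q by (intro sum.cong) (auto simp: basis_def)
  then show ?thesis using assms by (simp add: qnorm_def power_powr_inverse)
qed

lemma qnorm_lat_vec_ge:
  assumes t: "0 < t" "t \<le> 1" and b: "0 \<le> b" "b \<le> of_int (power_sum x)"
  shows "t * b powr (1 / real q) \<le> qnorm q n (lat_vec t x)"
proof -
  have "t * b powr (1 / real q) = (t ^ q * b) powr (1 / real q)"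
    using t b by (simp add: powr_mult power_powr_inverse)
  moreover have "t ^ q * b \<le> t ^ q * of_int (power_sum x)"
    using t b by (intro mult_left_mono) auto
  moreover note sum_lat_vec_ge[OF t, of x]
  ultimately show ?thesis
    using t b by (simp only: qnorm_ge_iff[of "t ^ q * b"] mult_nonneg_nonneg zero_le_power less_imp_le)
qed

lemma qnorm_lat_vec_ge_m:
  assumes t: "0 < t" "t \<le> 1" and nz: "\<exists>i<n. x i \<noteq> 0"
  shows "t * real m \<le> qnorm q n (lat_vec t x)"
proof -
  have "real_of_int (int m ^ q) \<le> of_int (power_sum x)"
    using power_sum_ge[OF nz] by (simp only: of_int_le_iff)
  then show ?thesis
    using qnorm_lat_vec_ge[OF t, of "real m ^ q" x] by (simp add: power_powr_inverse)
qed

text \<open>The bound forces \<open>m\<close> to divide \<open>x 0\<close>. A nonzero reduced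
  coordinate outside position 0 would contribute a full \<open>m^q\<close>, untouched by
  \<open>t\<close>, which exceeds \<open>(t * m)^q\<close> because \<open>t < 1\<close>. So the
  vector is a multiple of \<open>v\<close>.\<close>

lemma qnorm_lat_vec_minimal:
  assumes t: "0 < t" "t < 1" and le: "qnorm q n (lat_vec t x) \<le> t * real m"
  shows "\<forall>i<n. int (short_coeff i) dvd x i"
proof -
  let ?S = "\<Sum>i<n. \<bar>lat_vec t x i\<bar> ^ q"
  have "?S powr (1 / real q) \<le> ((t * real m) ^ q) powr (1 / real q)"
    using le t unfolding qnorm_def by (subst power_powr_inverse) auto
  then have S: "?S \<le> t ^ q * real m ^ q"
    using t by (subst (asm) powr_inverse_le_iff) (auto simp: sum_nonneg power_mult_distrib)
  have "t ^ q * of_int (power_sum x) \<le> t ^ q * real m ^ q"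
    by (rule order_trans[OF sum_lat_vec_ge S]) (use t in simp_all)
  then have "real_of_int (power_sum x) \<le> real_of_int (int m ^ q)"
    using t by simp
  then have le': "power_sum x \<le> int m ^ q" by (simp only: of_int_le_iff)
  then have dvd: "int m dvd x 0" using power_sum_not_dvd(1)[of x] by linarith
  have "reduced x l = 0" if l: "l < n" "l \<noteq> 0" for l
  proof (rule ccontr)
    assume "reduced x l \<noteq> 0"
    then have "\<bar>int m * 1\<bar> \<le> \<bar>coord x l\<bar>"
      unfolding coord_reduced[of x, OF dvd] abs_mult by (intro mult_left_mono) auto
    then have "real m ^ q \<le> \<bar>of_int (coord x l)\<bar> ^ q"
      by (intro power_mono) linarith+
    also have "\<dots> \<le> (\<Sum>i\<in>{..<n} - {0}. \<bar>of_int (coord x i)\<bar> ^ q)"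
      using l by (intro member_le_sum) auto
    also have "\<dots> \<le> ?S" unfolding sum_lat_vec[OF t(1)] using t by simp
    finally have "1 * real m ^ q \<le> t ^ q * real m ^ q" using S by simp
    moreover have "t ^ q < 1" using t q by (simp add: power_less_one_iff)
    ultimately show False using m_ge by (simp add: mult_less_cancel_right)
  qed
  then show ?thesis using reduced_0_imp_dvd[of x, OF dvd] by blast
qed

section \<open>Bases that contain a shortest vector\<close>

lemma lambda1_le:
  assumes t: "0 < t" "t < 1"
  shows "lambda1 q n (lattice_of n (basis t)) \<le> t * real m"
proof -
  \<comment> \<open>The coefficients of \<open>v\<close>: \<open>m\<close> times \<open>h\<close> is
    cancelled outside coordinate 0.\<close>
  define x where "x i = (if i = 0 then int m else - int (a i))" for i
  define v where "v i = (if i < n then lat_vec t x i else 0)" for i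
  have v: "v i = (if i = 0 then t * real m else 0)" for i
    using n_pos by (auto simp: v_def lat_vec_def coord_def x_def)
  have "v \<noteq> (\<lambda>_. 0)" using fun_cong[of v "\<lambda>_. 0" 0] v[of 0] t m_ge by auto
  moreover have "v \<in> lattice_of n (basis t)" unfolding lattice_basis v_def by blast
  moreover have "qnorm q n v = t * real m"
  proof -
    have "(\<Sum>i<n. \<bar>v i\<bar> ^ q) = (\<Sum>i<n. if i = 0 then (t * real m) ^ q else 0)"
      using q t by (intro sum.cong) (auto simp: v)
    then show ?thesis using t by (simp add: qnorm_def power_powr_inverse)
  qed
  moreover have "bdd_below {qnorm q n u | u. u \<in> lattice_of n (basis t) \<and> u \<noteq> (\<lambda>_. 0)}"
    by (intro bdd_belowI[of _ 0]) (auto simp: qnorm_def)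
  ultimately show ?thesis unfolding lambda1_def by (intro cInf_lower) (auto intro!: exI[of _ v])
qed

lemma basis_with_shortest:
  assumes t: "0 < t" "t < 1" and B: "is_basis n (lattice_of n (basis t)) B"
    and k: "k < n" "qnorm q n (B k) = lambda1 q n (lattice_of n (basis t))"
  shows "\<And>j. j < n \<Longrightarrow> t * real m \<le> qnorm q n (B j)"
    and "\<exists>j<n. t * (real m ^ q + 2) powr (1 / real q) \<le> qnorm q n (B j)"
proof -
  have indep: "lin_indep n B" and lat: "lattice_of n B = lattice_of n (basis t)"
    using B by (auto simp: is_basis_def)
  have "\<exists>x. \<forall>i<n. B j i = lat_vec t x i" if "j < n" for j
  proof -
    have eq: "(\<Sum>l<n. real_of_int (if l = j then 1 else 0) * B l i) = B j i" for i
      using that by (simp add: if_distrib[of of_int] if_distrib[of "\<lambda>x. x * _"] cong: if_cong)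
    have "(\<lambda>i. if i < n then B j i else 0) \<in> lattice_of n B"
      \<comment> \<open>A column may have arbitrary entries from index \<open>n\<close> on, so only
        its truncation lies in the lattice; the norm does not see the difference.\<close>
      unfolding lattice_of_def
      by (intro CollectI exI[of _ "\<lambda>l. if l = j then 1 else 0"]) (simp only: eq simp_thms)
    then obtain x where x: "(\<lambda>i. if i < n then B j i else 0) = (\<lambda>i. if i < n then lat_vec t x i else 0)"
      unfolding lat lattice_basis by blast
    have "B j i = lat_vec t x i" if "i < n" for i using fun_cong[OF x, of i] that by simp
    then show ?thesis by blast
  qed
  then obtain X where X: "\<And>j i. j < n \<Longrightarrow> i < n \<Longrightarrow> B j i = lat_vec t (X j) i" by metis
  have qB: "qnorm q n (B j) = qnorm q n (lat_vec t (X j))" if "j < n" for j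
    using X that by (intro qnorm_cong) auto
  show "t * real m \<le> qnorm q n (B j)" if j: "j < n" for j
  proof -
    have "\<exists>i<n. X j i \<noteq> 0"
    proof (rule ccontr)
      assume *: "\<not> ?thesis"
      have "B j i = 0" if "i < n" for i
        using * that by (simp add: X[OF j] lat_vec_def coord_def)
      then have "\<forall>i<n. (\<Sum>l<n. (if l = j then 1 else 0) * B l i) = 0"
        using j by (simp add: if_distrib[of "\<lambda>x. x * _"] cong: if_cong)
      then have "(if j = j then 1 else 0 :: real) = 0"
        using indep j unfolding lin_indep_def
        by (elim allE[of _ "\<lambda>l. if l = j then 1 else 0"]) blast
      then show False by simp
    qed
    then show ?thesis using qnorm_lat_vec_ge_m[of t] t qB[OF j] by simp
  qed
  show "\<exists>j<n. t * (real m ^ q + 2) powr (1 / real q) \<le> qnorm q n (B j)"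
  proof (rule ccontr)
    assume *: "\<not> ?thesis"
    \<comment> \<open>Column \<open>k\<close> is as short as \<open>v\<close>, hence a multiple of
      it.\<close>
    have dvdk: "int (short_coeff i) dvd X k i" if "i < n" for i
      using qnorm_lat_vec_minimal[of t "X k"] t lambda1_le[OF t] k qB[OF k(1)] that by auto
    have cases: "(\<exists>l<n. \<forall>i<n. i \<noteq> l \<longrightarrow> X j i = 0) \<or> (\<forall>i<n. int (short_coeff i) dvd X j i)"
      if j: "j < n" for j
    proof (rule short_cases, rule ccontr)
      assume "\<not> power_sum (X j) < int m ^ q + 2"
      then have "real_of_int (int m ^ q + 2) \<le> of_int (power_sum (X j))"
        by (simp only: of_int_le_iff not_less)
      then show False
        using qnorm_lat_vec_ge[of t "real m ^ q + 2" "X j"] t * j qB[OF j] by auto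
    qed
    \<comment> \<open>For a column that is a multiple of one generator, \<open>f\<close> picks the
      index of such a generator; for other columns its value is arbitrary.\<close>
    define f where "f j = (SOME l. \<forall>i<n. i \<noteq> l \<longrightarrow> X j i = 0)" for j
    have f: "X j i = 0" if "\<exists>l. \<forall>i<n. i \<noteq> l \<longrightarrow> X j i = 0" "i < n" "i \<noteq> f j" for i j
      using someI_ex[OF that(1)] that(2,3) unfolding f_def by blast
    \<comment> \<open>Pigeonhole: the \<open>n - 1\<close> columns other than \<open>k\<close>
      cannot account for all \<open>n\<close> generators.\<close>
    have "card (f ` ({..<n} - {k})) \<le> card ({..<n} - {k})" by (intro card_image_le) auto
    also have "\<dots> < card {..<n}" using k by (intro psubset_card_mono) auto
    finally have "\<not> {..<n} \<subseteq> f ` ({..<n} - {k})"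
      by (meson card_mono finite_Diff finite_imageI finite_lessThan not_less)
    then obtain l where l: "l < n" "\<And>j. j < n \<Longrightarrow> j \<noteq> k \<Longrightarrow> f j \<noteq> l" by blast
    have dvd: "int (short_coeff l) dvd X j l" if j: "j < n" for j
    proof (cases "j = k \<or> (\<forall>i<n. int (short_coeff i) dvd X j i)")
      case True
      then show ?thesis using dvdk l by blast
    next
      case False
      then have "X j l = 0" using cases[OF j] f[of j l] l j by blast
      then show ?thesis by simp
    qed
    \<comment> \<open>Generator \<open>l\<close> has \<open>l\<close>-th coefficient 1, yet it is an
      integer combination of columns whose \<open>l\<close>-th coefficients are all divisible by
      \<open>short_coeff l\<close>.\<close>
    let ?e = "\<lambda>i. if i = l then 1 else 0 :: int"
    have "(\<lambda>i. if i < n then lat_vec t ?e i else 0) \<in> lattice_of n B"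
      unfolding lat lattice_basis by blast
    then obtain d where d: "(\<lambda>i. if i < n then lat_vec t ?e i else 0) =
        (\<lambda>i. if i < n then (\<Sum>j<n. real_of_int (d j) * B j i) else 0)"
      unfolding lattice_of_def by blast
    have "lat_vec t ?e i = lat_vec t (\<lambda>i. \<Sum>j<n. d j * X j i) i" if "i < n" for i
      using fun_cong[OF d, of i] that by (simp add: lat_vec_sum X)
    then have "?e l = (\<Sum>j<n. d j * X j l)" using t l by (intro lat_vec_inj) auto
    then have "(\<Sum>j<n. d j * X j l) = 1" by simp
    moreover have "int (short_coeff l) dvd (\<Sum>j<n. d j * X j l)"
      using dvd by (intro dvd_sum dvd_mult) simp
    ultimately have "int (short_coeff l) dvd 1" by metis
    then show False using short_coeff_not_dvd_1 l by blast
  qed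
qed

end

section \<open>Choice of \<open>t\<close> according to the cost\<close>

theorem theorem1p2:
  fixes q :: nat and s :: enat
  assumes "q \<ge> 1" and "s \<ge> 1"
  shows "\<exists>n B0. n \<ge> 1 \<and> lin_indep n B0 \<and>
           \<not> (\<exists>B. is_basis n (lattice_of n B0) B
                  \<and> (\<exists>i<n. qnorm q n (B i) = lambda1 q n (lattice_of n B0))
                  \<and> (\<forall>B'. is_basis n (lattice_of n B0) B' \<longrightarrow>
                          basis_cost q s n B \<le> basis_cost q s n B'))"
proof -
  interpret exponent q by unfold_locales (rule assms)
  \<comment> \<open>All generators have norm at most \<alpha>, while a basis with a shortest vector
    has a column of norm at least \<open>t * \<beta>\<close>.\<close>
  define \<alpha> where "\<alpha> = (real m ^ q + 1) powr (1 / real q)"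
  define \<beta> where "\<beta> = (real m ^ q + 2) powr (1 / real q)"
  have \<alpha>0: "0 < \<alpha>" unfolding \<alpha>_def
    by (metis add_nonneg_pos of_nat_0_le_iff powr_gt_zero zero_le_power zero_less_one less_irrefl)
  have \<alpha>\<beta>: "\<alpha> < \<beta>"
    unfolding \<alpha>_def \<beta>_def using assms(1) by (intro powr_less_mono2) auto
  have m\<alpha>: "real m \<le> \<alpha>"
    unfolding \<alpha>_def using powr_mono2[of "1 / real q" "real m ^ q" "real m ^ q + 1"]
    by (simp add: power_powr_inverse)
  \<comment> \<open>It remains to find \<open>t\<close> for which these column bounds alone force a
    cost above that of the generators.\<close>
  have *: "\<exists>n B0. n \<ge> 1 \<and> lin_indep n B0 \<and>
           \<not> (\<exists>B. is_basis n (lattice_of n B0) B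
                  \<and> (\<exists>i<n. qnorm q n (B i) = lambda1 q n (lattice_of n B0))
                  \<and> (\<forall>B'. is_basis n (lattice_of n B0) B' \<longrightarrow>
                          basis_cost q s n B \<le> basis_cost q s n B'))"
    if t: "0 < t" "t < 1"
      and cost: "\<And>B j. \<lbrakk>\<And>j. j < n \<Longrightarrow> t * real m \<le> qnorm q n (B j); j < n; t * \<beta> \<le> qnorm q n (B j)\<rbrakk>
        \<Longrightarrow> basis_cost q s n (basis t) < basis_cost q s n B" for t
  proof (intro exI conjI notI)
    show "1 \<le> n" using n_pos by linarith
    show indep: "lin_indep n (basis t)" by (rule lin_indep_basis[OF t(1)])
    assume "\<exists>B. is_basis n (lattice_of n (basis t)) B
        \<and> (\<exists>i<n. qnorm q n (B i) = lambda1 q n (lattice_of n (basis t)))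
        \<and> (\<forall>B'. is_basis n (lattice_of n (basis t)) B' \<longrightarrow> basis_cost q s n B \<le> basis_cost q s n B')"
    then obtain B k where B: "is_basis n (lattice_of n (basis t)) B"
      and k: "k < n" "qnorm q n (B k) = lambda1 q n (lattice_of n (basis t))"
      and opt: "\<And>B'. is_basis n (lattice_of n (basis t)) B' \<Longrightarrow> basis_cost q s n B \<le> basis_cost q s n B'"
      by blast
    obtain j where "j < n" "t * \<beta> \<le> qnorm q n (B j)"
      using basis_with_shortest(2)[OF t B k] unfolding \<beta>_def by blast
    then have "basis_cost q s n (basis t) < basis_cost q s n B"
      using cost basis_with_shortest(1)[OF t B k] by blast
    moreover have "is_basis n (lattice_of n (basis t)) (basis t)"
      using indep by (simp add: is_basis_def)
    ultimately show False using opt[of "basis t"] by simp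
  qed
  show ?thesis
  proof (cases s)
    case (enat k)
    then have k: "0 < k" using assms(2) by (cases k) (auto simp: enat_0 simp flip: zero_enat_def)
    \<comment> \<open>The generators cost at most \<open>P\<close>, the competing basis at least
      \<open>t^k * Q\<close>. As \<open>P < Q\<close>, some \<open>t < 1\<close> has
      \<open>t^k\<close> above \<open>P / Q\<close>.\<close>
    define P where "P = real (n - 1) * real m ^ k + \<alpha> ^ k"
    define Q where "Q = real (n - 1) * real m ^ k + \<beta> ^ k"
    have "\<alpha> ^ k < \<beta> ^ k" using \<alpha>\<beta> \<alpha>0 k by (intro power_strict_mono) auto
    moreover have P0: "0 < P" unfolding P_def using \<alpha>0 by (intro add_nonneg_pos) auto
    ultimately have PQ: "P < Q" "0 < Q" by (auto simp: P_def Q_def)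
    then obtain u where u: "P / Q < u" "u < 1" using dense[of "P / Q" 1] by auto
    have u0: "0 < u" using u(1) P0 PQ by (meson divide_pos_pos less_trans)
    define t where "t = root k u"
    have tk: "t ^ k = u" and t: "0 < t" "t < 1"
      using k u u0 by (simp_all add: t_def)
    show ?thesis
    proof (rule *[OF t])
      fix B j assume ge: "\<And>j. j < n \<Longrightarrow> t * real m \<le> qnorm q n (B j)"
        and j: "j < n" "t * \<beta> \<le> qnorm q n (B j)"
      have "basis_cost q s n (basis t) = qnorm q n (basis t 0) ^ k + (\<Sum>j\<in>{..<n} - {0}. real m ^ k)"
        unfolding basis_cost_def enat enat.simps sum.remove[of "{..<n}" 0, simplified]
        by (simp add: qnorm_basis)
      also have "qnorm q n (basis t 0) \<le> \<alpha>" unfolding \<alpha>_def using t by (intro qnorm_basis_0) auto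
      then have "qnorm q n (basis t 0) ^ k \<le> \<alpha> ^ k"
        by (intro power_mono) (simp_all add: qnorm_def)
      then have "qnorm q n (basis t 0) ^ k + (\<Sum>j\<in>{..<n} - {0}. real m ^ k) \<le> P"
        by (simp add: P_def)
      also have "P < u * Q" using u PQ by (simp add: field_simps)
      also have "\<dots> = (t * \<beta>) ^ k + (\<Sum>i\<in>{..<n} - {j}. (t * real m) ^ k)"
        using j by (simp add: Q_def power_mult_distrib tk algebra_simps)
      also have "\<dots> \<le> qnorm q n (B j) ^ k + (\<Sum>i\<in>{..<n} - {j}. qnorm q n (B i) ^ k)"
        using t \<alpha>0 \<alpha>\<beta> by (intro add_mono sum_mono power_mono ge j) auto
      also have "\<dots> = basis_cost q s n B"
        using j by (simp add: basis_cost_def enat sum.remove[of "{..<n}" j])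
      finally show "basis_cost q s n (basis t) < basis_cost q s n B" .
    qed
  next
    case infinity
    \<comment> \<open>For the maximum it is enough that
      \<open>\<alpha> < t * \<beta>\<close>.\<close>
    have "\<alpha> / \<beta> < 1" using \<alpha>\<beta> \<alpha>0 by simp
    then obtain t where t': "\<alpha> / \<beta> < t" and t: "t < 1" using dense by blast
    have t0: "0 < t" using t' \<alpha>0 \<alpha>\<beta> by (meson divide_pos_pos less_trans)
    show ?thesis
    proof (rule *[OF t0 t])
      fix B j assume j: "j < n" "t * \<beta> \<le> qnorm q n (B j)"
      have "qnorm q n (basis t i) \<le> \<alpha>" if "i < n" for i
        using qnorm_basis_0[of t] t t0 qnorm_basis[OF that, of t] m\<alpha>
        by (cases "i = 0") (auto simp: \<alpha>_def)
      then have "basis_cost q s n (basis t) \<le> \<alpha>"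
        unfolding basis_cost_def infinity enat.simps using n_pos
        by (subst Max_le_iff) (auto simp: lessThan_empty_iff)
      also have "\<alpha> < t * \<beta>" using t' \<alpha>0 \<alpha>\<beta> by (simp add: field_simps)
      also have "\<dots> \<le> qnorm q n (B j)" by (rule j)
      also have "\<dots> \<le> basis_cost q s n B"
        unfolding basis_cost_def infinity enat.simps using j by (intro Max_ge) auto
      finally show "basis_cost q s n (basis t) < basis_cost q s n B" .
    qed
  qed
qed

end
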